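(* Let $\{\langle X_t,G_t\rangle\}_{t\ge 0}$, $G_t=(\mathbb{N},E,C_t)$, be a proper, monotone increasing, possibly adaptive random walk in changing environment on $\mathbb{N}$, where $E=\{\{j,j+1\}:j\ge 0\}$. Suppose that $G_0$ is transient and that the process is bounded from above by some transient weighted graph $G_\infty=(\mathbb{N},E,C_\infty)$ (that is, $C_t(e)\le C_\infty(e)$ for all $e\in E$ and all $t$, almost surely). Then the walk is transient, i.e. almost surely $X_t$ visits every vertex of $\mathbb{N}$ only finitely many times.
   Context: A random walk in changing environment (RWCE) on a graph $G=(V,E)$ is a stochastic process $\{\langle X_t,G_t\rangle\}_{t=0}^\infty$ where $X_t\in V$ and $G_t=(V,E,C_t)$ is the graph $G$ equipped with a (random) conductance function $C_t:E\to[0,\infty)$, with total conductance at each vertex finite, such that for all $t$ and $v$, $$\mathbb{P}(X_{t+1}=v\mid \langle X_0,G_0\rangle,\dots,\langle X_t,G_t\rangle)=\frac{C_t(X_t,v)}{\sum_{e\in E: X_t\in e}C_t(e)}.$$ The conductances $C_t$ may depend on the whole history of the process and on extra randomness; "possibly adaptive" means no restriction is placed on this dependence. The RWCE is proper if $0<C_t(e)<\infty$ for all $t$ and $e$. It is monotone increasing if $C_{t+1}\ge C_t$ (edgewise) almost surely for all $t$. Here $\mathbb{N}=\{0,1,2,\dots\}$. A weighted graph is called transient if the usual weighted (reversible) random walk on it is transient; for $\mathbb{N}$ with positive conductances $C$ this means $\sum_{j\ge0}1/C(j,j+1)<\infty$. The bounding graph $G_\infty$ is deterministic. *)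

theory Defs
  imports "HOL-Probability.Probability"
begin

definition total_conductance :: "'v set set \<Rightarrow> ('v set \<Rightarrow> real) \<Rightarrow> 'v \<Rightarrow> real" where
  "total_conductance E c x = (\<Sum>\<^sub>\<infinity>e\<in>{e \<in> E. x \<in> e}. c e)"

definition transition_prob :: "'v set set \<Rightarrow> ('v set \<Rightarrow> real) \<Rightarrow> 'v \<Rightarrow> 'v \<Rightarrow> real" where
  "transition_prob E c x v = (if {x, v} \<in> E then c {x, v} else 0) / total_conductance E c x"

text \<open>
  The sigma-algebra generated by the positions \<open>X s\<close> and the conductances \<open>C s _ e\<close>
  for all \<open>s \<le> t\<close> and all edges \<open>e\<close>.
\<close>

definition history ::
  "'w measure \<Rightarrow> 'v set set \<Rightarrow> (nat \<Rightarrow> 'w \<Rightarrow> 'v) \<Rightarrow> (nat \<Rightarrow> 'w \<Rightarrow> 'v set \<Rightarrow> real) \<Rightarrow> nat \<Rightarrow> 'w measure"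
where
  "history M E X C t = sigma (space M)
     ({X s -` A \<inter> space M | s A. s \<le> t} \<union>
      {(\<lambda>\<omega>. C s \<omega> e) -` B \<inter> space M | s e B. s \<le> t \<and> e \<in> E \<and> B \<in> sets borel})"

text \<open>
  Random walk in changing environment. The vertex set is the whole countable type \<open>'v\<close>; an edge
  is the set of its endpoints. Conductance functions are total functions on \<open>'v set\<close>, but only
  their values on \<open>E\<close> are ever used. Adaptivity is unrestricted: the conductances are arbitrary
  random variables, subject only to the conditional law of the next step.
\<close>

locale rwce = prob_space M
  for M :: "'w measure" +
  fixes E :: "'v::countable set set"
    and X :: "nat \<Rightarrow> 'w \<Rightarrow> 'v"
    and C :: "nat \<Rightarrow> 'w \<Rightarrow> 'v set \<Rightarrow> real"
  assumes edges: "e \<in> E \<Longrightarrow> \<exists>x y. e = {x, y}"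
    and X_measurable: "X t \<in> measurable M (count_space UNIV)"
    and C_measurable: "e \<in> E \<Longrightarrow> (\<lambda>\<omega>. C t \<omega> e) \<in> borel_measurable M"
    and C_nonneg: "\<omega> \<in> space M \<Longrightarrow> e \<in> E \<Longrightarrow> 0 \<le> C t \<omega> e"
    and C_finite: "\<omega> \<in> space M \<Longrightarrow> C t \<omega> summable_on {e \<in> E. x \<in> e}"
    and step: "AE \<omega> in M.
        real_cond_exp M (history M E X C t) (indicator {\<omega> \<in> space M. X (Suc t) \<omega> = v}) \<omega>
          = transition_prob E (C t \<omega>) (X t \<omega>) v"

definition proper_env :: "'w measure \<Rightarrow> 'v set set \<Rightarrow> (nat \<Rightarrow> 'w \<Rightarrow> 'v set \<Rightarrow> real) \<Rightarrow> bool" where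
  "proper_env M E C \<longleftrightarrow> (AE \<omega> in M. \<forall>t. \<forall>e\<in>E. 0 < C t \<omega> e)"

definition increasing_env :: "'w measure \<Rightarrow> 'v set set \<Rightarrow> (nat \<Rightarrow> 'w \<Rightarrow> 'v set \<Rightarrow> real) \<Rightarrow> bool" where
  "increasing_env M E C \<longleftrightarrow> (AE \<omega> in M. \<forall>t. \<forall>e\<in>E. C t \<omega> e \<le> C (Suc t) \<omega> e)"

definition bounded_above_env ::
  "'w measure \<Rightarrow> 'v set set \<Rightarrow> (nat \<Rightarrow> 'w \<Rightarrow> 'v set \<Rightarrow> real) \<Rightarrow> ('v set \<Rightarrow> real) \<Rightarrow> bool" where
  "bounded_above_env M E C c \<longleftrightarrow> (AE \<omega> in M. \<forall>t. \<forall>e\<in>E. C t \<omega> e \<le> c e)"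

definition transient_walk :: "'w measure \<Rightarrow> (nat \<Rightarrow> 'w \<Rightarrow> 'v) \<Rightarrow> bool" where
  "transient_walk M X \<longleftrightarrow> (AE \<omega> in M. \<forall>v. finite {t. X t \<omega> = v})"

text \<open>
  The law, on the space of vertex sequences, of the weighted (reversible) random walk on \<open>(E, c)\<close>
  started at \<open>x\<close>: the coordinate process is a walk in the constant environment \<open>c\<close>, so that its
  history is just the history of the positions.
\<close>

definition weighted_walk_law ::
  "'v::countable set set \<Rightarrow> ('v set \<Rightarrow> real) \<Rightarrow> 'v \<Rightarrow> (nat \<Rightarrow> 'v) measure \<Rightarrow> bool" where
  "weighted_walk_law E c x P \<longleftrightarrow>
     sets P = sets (PiM UNIV (\<lambda>_. count_space UNIV)) \<and>
     rwce P E (\<lambda>t \<omega>. \<omega> t) (\<lambda>t \<omega>. c) \<and>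
     (AE \<omega> in P. \<omega> 0 = x)"

text \<open>
  The law is uniquely determined by \<open>E\<close>, \<open>c\<close> and \<open>x\<close>, so the existential quantifier below merely
  refers to \<^emph>\<open>the\<close> walk started at \<open>x\<close>.
\<close>

definition transient_graph :: "'v::countable set set \<Rightarrow> ('v set \<Rightarrow> real) \<Rightarrow> bool" where
  "transient_graph E c \<longleftrightarrow>
     (\<forall>x. \<exists>P. weighted_walk_law E c x P \<and> transient_walk P (\<lambda>t \<omega>. \<omega> t))"

definition nat_edges :: "nat set set" where
  "nat_edges = {{j, Suc j} | j. True}"

end

theory Submission
  imports Defs
begin

text \<open>
  Let \<open>R t x\<close> be the sum of \<open>1 / C t {j, j + 1}\<close> over \<open>j \<ge> x\<close>. Away from \<open>0\<close> it is harmonic in \<open>x\<close> for the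
  conductances \<open>C t\<close>, it decreases in \<open>t\<close>, and a step from \<open>0\<close> lowers it by \<open>1 / C t {0, 1} \<ge> 1 / C_inf {0, 1}\<close>.
  Hence on the event \<open>R 0 0 \<le> k\<close> the process \<open>R t (X t)\<close> is a nonnegative supermartingale, and the total
  drop bounds the expected number of visits to \<open>0\<close>. On the same event every \<open>C 0 {v, v + 1}\<close> is at least
  \<open>1 / k\<close>, so a step from \<open>v + 1\<close> to \<open>v\<close> has probability bounded below by a constant, and finiteness of
  the expected number of visits propagates from \<open>v\<close> to \<open>v + 1\<close>.

  That \<open>R 0 0\<close> is finite when the starting graph is transient is the classical criterion: if it were
  infinite, the harmonic function \<open>h x = (\<Sum>j<x. 1 / c {j, j + 1})\<close> would be unbounded, and Fatou's lemma for
  \<open>h\<close> along a transient walk, restricted to the event of not hitting \<open>0\<close> after time \<open>T\<close>, would show that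
  this event is null for every \<open>T\<close>.
\<close>

section \<open>Conditioning one step of the walk on the history\<close>

context rwce
begin

lemma subalgebra_history: "subalgebra M (history M E X C t)"
proof -
  have "sets (history M E X C t) \<subseteq> sets M"
    unfolding history_def
  proof (subst sets_measure_of, blast, rule sets.sigma_sets_subset, safe)
    fix s :: nat and A :: "'v set"
    show "X s -` A \<inter> space M \<in> sets M"
      using measurable_sets[OF X_measurable[of s], of A] by simp
  next
    fix s :: nat and e and B :: "real set"
    assume "e \<in> E" "B \<in> sets borel"
    then show "(\<lambda>\<omega>. C s \<omega> e) -` B \<inter> space M \<in> sets M"
      using measurable_sets[OF C_measurable] by blast
  qed
  then show ?thesis
    by (simp add: subalgebra_def history_def space_measure_of_conv)
qed

lemma space_history [simp]: "space (history M E X C t) = space M"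
  by (simp add: history_def space_measure_of_conv)

lemma measurable_history_position:
  assumes "s \<le> t"
  shows "X s \<in> measurable (history M E X C t) (count_space UNIV)"
proof (rule measurableI)
  fix A :: "'v set"
  show "X s -` A \<inter> space (history M E X C t) \<in> sets (history M E X C t)"
    unfolding space_history using assms
    by (unfold history_def, subst sets_measure_of, blast) (rule sigma_sets.Basic, blast)
qed simp

lemma measurable_history_conductance:
  assumes "s \<le> t" "e \<in> E"
  shows "(\<lambda>\<omega>. C s \<omega> e) \<in> borel_measurable (history M E X C t)"
proof (rule measurableI)
  fix B :: "real set"
  assume "B \<in> sets borel"
  then show "(\<lambda>\<omega>. C s \<omega> e) -` B \<inter> space (history M E X C t) \<in> sets (history M E X C t)"
    unfolding space_history using assms
    by (unfold history_def, subst sets_measure_of, blast) (rule sigma_sets.Basic, blast)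
qed simp

text \<open>Split by the value of the next position: each \<open>\<phi> v\<close> is known at time
  \<open>t\<close>, so only the conditional probability of moving to \<open>v\<close> enters.
  Working in \<open>ennreal\<close> allows Tonelli without integrability.\<close>

lemma nn_integral_step:
  assumes \<phi>: "\<And>v. \<phi> v \<in> borel_measurable (history M E X C t)"
  shows "(\<integral>\<^sup>+\<omega>. \<phi> (X (Suc t) \<omega>) \<omega> \<partial>M) =
    (\<integral>\<^sup>+\<omega>. (\<integral>\<^sup>+v. \<phi> v \<omega> * ennreal (transition_prob E (C t \<omega>) (X t \<omega>) v) \<partial>count_space UNIV) \<partial>M)"
proof -
  let ?F = "history M E X C t"
  interpret F: finite_measure_subalgebra M ?F
    by unfold_locales (rule subalgebra_history)
  have [measurable]: "\<phi> v \<in> borel_measurable M" for v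
    by (rule measurable_from_subalg[OF subalgebra_history \<phi>])
  note X_measurable[measurable]
  let ?I = "\<lambda>v. indicator {\<omega> \<in> space M. X (Suc t) \<omega> = v}"
  define N where "N v = nn_cond_exp M ?F (\<lambda>\<omega>. ennreal (?I v \<omega>))" for v
  have N[measurable]: "N v \<in> borel_measurable M" for v
    unfolding N_def by measurable
  have step': "AE \<omega> in M. N v \<omega> = ennreal (transition_prob E (C t \<omega>) (X t \<omega>) v)" for v
  proof -
    \<comment> \<open>\<open>real_cond_exp\<close> is a difference of \<open>enn2real\<close>
      values, and \<open>enn2real\<close> sends infinity to 0. To recover \<open>N v\<close> from
      it, the negative part must vanish and \<open>N v\<close> must be finite, which follows from
      the bound 1.\<close>
    have negative_part: "(\<lambda>\<omega>. ennreal (- ?I v \<omega>)) = (\<lambda>_. 0)"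
      by (auto simp: indicator_def ennreal_neg)
    have "AE \<omega> in M. N v \<omega> \<le> nn_cond_exp M ?F (\<lambda>_. 1) \<omega>"
      unfolding N_def by (rule F.nn_cond_exp_mono) (auto simp: indicator_def)
    moreover have "AE \<omega> in M. 1 = nn_cond_exp M ?F (\<lambda>_. 1) \<omega>"
      by (rule F.nn_cond_exp_F_meas) simp
    moreover have "AE \<omega> in M. 0 = nn_cond_exp M ?F (\<lambda>_. 0) \<omega>"
      by (rule F.nn_cond_exp_F_meas) simp
    ultimately show ?thesis
      using step[of t v]
    proof eventually_elim
      case (elim \<omega>)
      then have "enn2real (N v \<omega>) = transition_prob E (C t \<omega>) (X t \<omega>) v"
        by (simp add: real_cond_exp_def N_def negative_part)
      moreover have "N v \<omega> < \<top>"
        using elim(1,2) by (metis ennreal_one_less_top le_less_trans)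
      ultimately show ?case
        by (metis ennreal_enn2real)
    qed
  qed
  have "(\<integral>\<^sup>+\<omega>. \<phi> (X (Suc t) \<omega>) \<omega> \<partial>M) =
      (\<integral>\<^sup>+\<omega>. (\<integral>\<^sup>+v. \<phi> v \<omega> * ennreal (?I v \<omega>) \<partial>count_space UNIV) \<partial>M)"
  proof (rule nn_integral_cong)
    fix \<omega> assume "\<omega> \<in> space M"
    then show "\<phi> (X (Suc t) \<omega>) \<omega> = (\<integral>\<^sup>+v. \<phi> v \<omega> * ennreal (?I v \<omega>) \<partial>count_space UNIV)"
      by (subst nn_integral_count_space'[where A = "{X (Suc t) \<omega>}"]) (auto simp: indicator_def)
  qed
  also have "\<dots> = (\<integral>\<^sup>+v. (\<integral>\<^sup>+\<omega>. \<phi> v \<omega> * ennreal (?I v \<omega>) \<partial>M) \<partial>count_space UNIV)"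
    by (rule nn_integral_count_space_nn_integral) auto
  \<comment> \<open>Measurability of \<open>\<phi> v\<close> with respect to the history permits
    replacing the indicator by its conditional expectation.\<close>
  also have "\<dots> = (\<integral>\<^sup>+v. (\<integral>\<^sup>+\<omega>. \<phi> v \<omega> * N v \<omega> \<partial>M) \<partial>count_space UNIV)"
    unfolding N_def by (intro nn_integral_cong F.nn_cond_exp_intg[symmetric] \<phi>) measurable
  also have "\<dots> = (\<integral>\<^sup>+\<omega>. (\<integral>\<^sup>+v. \<phi> v \<omega> * N v \<omega> \<partial>count_space UNIV) \<partial>M)"
    by (rule nn_integral_count_space_nn_integral[symmetric]) auto
  also have "\<dots> = (\<integral>\<^sup>+\<omega>. (\<integral>\<^sup>+v. \<phi> v \<omega> * ennreal (transition_prob E (C t \<omega>) (X t \<omega>) v)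
      \<partial>count_space UNIV) \<partial>M)"
  proof (rule nn_integral_cong_AE)
    have "AE \<omega> in M. \<forall>v. N v \<omega> = ennreal (transition_prob E (C t \<omega>) (X t \<omega>) v)"
      using step' by (simp add: AE_all_countable)
    then show "AE \<omega> in M. (\<integral>\<^sup>+v. \<phi> v \<omega> * N v \<omega> \<partial>count_space UNIV) =
       (\<integral>\<^sup>+v. \<phi> v \<omega> * ennreal (transition_prob E (C t \<omega>) (X t \<omega>) v) \<partial>count_space UNIV)"
      by eventually_elim simp
  qed
  finally show ?thesis .
qed

end

section \<open>Transition probabilities on the half-line\<close>

lemma edge_in_nat_edges [simp]: "{j, Suc j} \<in> nat_edges"
  by (auto simp: nat_edges_def)

lemma nat_edges_iff: "{x, v} \<in> nat_edges \<longleftrightarrow> v = Suc x \<or> x = Suc v"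
  by (auto simp: nat_edges_def doubleton_eq_iff)

lemma incident_nat_edges_0: "{e \<in> nat_edges. 0 \<in> e} = {{0, Suc 0}}"
  by (auto simp: nat_edges_def)

lemma incident_nat_edges_Suc: "{e \<in> nat_edges. Suc x \<in> e} = {{x, Suc x}, {Suc x, Suc (Suc x)}}"
  by (auto simp: nat_edges_def)

lemma total_conductance_0: "total_conductance nat_edges c 0 = c {0, Suc 0}"
  by (simp add: total_conductance_def incident_nat_edges_0)

lemma total_conductance_Suc:
  "total_conductance nat_edges c (Suc x) = c {x, Suc x} + c {Suc x, Suc (Suc x)}"
  by (simp add: total_conductance_def incident_nat_edges_Suc doubleton_eq_iff)

lemma transition_sum_0:
  fixes \<phi> :: "nat \<Rightarrow> ennreal"
  assumes "0 < c {0, Suc 0}"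
  shows "(\<integral>\<^sup>+v. \<phi> v * ennreal (transition_prob nat_edges c 0 v) \<partial>count_space UNIV) = \<phi> (Suc 0)"
  using assms
  by (subst nn_integral_count_space'[where A = "{Suc 0}"])
     (auto simp: transition_prob_def total_conductance_0 nat_edges_iff)

lemma transition_sum_Suc:
  fixes \<phi> :: "nat \<Rightarrow> ennreal" and c :: "nat set \<Rightarrow> real" and x :: nat
  defines "a \<equiv> c {x, Suc x}" and "b \<equiv> c {Suc x, Suc (Suc x)}"
  shows "(\<integral>\<^sup>+v. \<phi> v * ennreal (transition_prob nat_edges c (Suc x) v) \<partial>count_space UNIV) =
    \<phi> x * ennreal (a / (a + b)) + \<phi> (Suc (Suc x)) * ennreal (b / (a + b))"
  by (subst nn_integral_count_space'[where A = "{x, Suc (Suc x)}"])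
     (auto simp: transition_prob_def total_conductance_Suc nat_edges_iff a_def b_def insert_commute)

text \<open>Harmonicity at a vertex between two resistors in series: \<open>z\<close> is the
  potential beyond the edge of conductance \<open>b\<close>, and unit current raises it by
  \<open>1 / b\<close> and then by \<open>1 / a\<close>. The value \<open>z\<close> may be
  infinite.\<close>

lemma ennreal_weighted_resistance:
  assumes "0 < a" "0 < b"
  shows "(z + (ennreal (1 / a) + ennreal (1 / b))) * ennreal (a / (a + b)) + z * ennreal (b / (a + b))
    = z + ennreal (1 / b)"
proof -
  have "(1 / a + 1 / b) * (a / (a + b)) = 1 / b"
    using assms by (simp add: divide_simps)
  then have 1: "(ennreal (1 / a) + ennreal (1 / b)) * ennreal (a / (a + b)) = ennreal (1 / b)"
    using assms by (simp flip: ennreal_plus ennreal_mult)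
  have "a / (a + b) + b / (a + b) = 1"
    using assms by (simp flip: add_divide_distrib)
  then have 2: "z * (ennreal (a / (a + b)) + ennreal (b / (a + b))) = z"
    using assms by (simp flip: ennreal_plus)
  show ?thesis
    unfolding distrib_right 1[unfolded distrib_right]
    using 1 2 by (simp add: distrib_left distrib_right ac_simps)
qed

section \<open>Series resistances as harmonic functions, and the transience criterion\<close>

definition resistance :: "(nat set \<Rightarrow> real) \<Rightarrow> nat \<Rightarrow> ennreal" where
  "resistance c j = ennreal (1 / c {j, Suc j})"

text \<open>For positive conductances, the effective resistance between \<open>x\<close> and
  infinity; this is \<open>R t x\<close> of the overview when \<open>c\<close> is
  \<open>C t\<close>.\<close>

definition tail_resistance :: "(nat set \<Rightarrow> real) \<Rightarrow> nat \<Rightarrow> ennreal" where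
  "tail_resistance c x = (\<Sum>j. resistance c (x + j))"

lemma tail_resistance_Suc: "tail_resistance c x = tail_resistance c (Suc x) + resistance c x"
  unfolding tail_resistance_def
  by (subst suminf_offset[where i = 1]) (simp_all add: add.commute)

lemma tail_resistance_antimono: "x \<le> y \<Longrightarrow> tail_resistance c y \<le> tail_resistance c x"
  by (rule lift_Suc_antimono_le[where f = "tail_resistance c"]) (subst (2) tail_resistance_Suc, simp_all)

lemma resistance_le_tail: "resistance c x \<le> tail_resistance c 0"
proof -
  have "resistance c x \<le> tail_resistance c x"
    by (subst tail_resistance_Suc) simp
  also have "\<dots> \<le> tail_resistance c 0"
    by (rule tail_resistance_antimono) simp
  finally show ?thesis .
qed

text \<open>Rayleigh monotonicity, termwise for resistors in series.\<close>

lemma tail_resistance_mono: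
  assumes "\<And>e. e \<in> nat_edges \<Longrightarrow> 0 < c e" "\<And>e. e \<in> nat_edges \<Longrightarrow> c e \<le> d e"
  shows "tail_resistance d x \<le> tail_resistance c x"
  unfolding tail_resistance_def resistance_def
  by (intro suminf_le summableI ennreal_leI divide_left_mono assms mult_pos_pos edge_in_nat_edges
      order.strict_trans2[OF assms(1) assms(2)]) (auto)

text \<open>The argument \<open>max 1 x\<close> merges harmonicity away from 0 with the forced step
  from 0 to 1.\<close>

lemma transition_tail_resistance:
  assumes pos: "\<And>j. 0 < c {j, Suc j}"
  shows "(\<integral>\<^sup>+v. tail_resistance c v * ennreal (transition_prob nat_edges c x v) \<partial>count_space UNIV)
    = tail_resistance c (max 1 x)"
proof (cases x)
  case 0
  then show ?thesis
    using pos by (simp add: transition_sum_0)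
next
  case (Suc y)
  have "tail_resistance c y = tail_resistance c (Suc x) +
      (ennreal (1 / c {y, Suc y}) + ennreal (1 / c {Suc y, Suc (Suc y)}))"
    by (simp add: Suc tail_resistance_Suc[of c y] tail_resistance_Suc[of c "Suc y"] resistance_def ac_simps)
  then show ?thesis
    unfolding Suc transition_sum_Suc
    by (simp add: ennreal_weighted_resistance[OF pos pos] tail_resistance_Suc[of c "Suc y"] resistance_def)
qed

text \<open>The function \<open>h\<close> of the overview: the effective resistance between 0 and
  \<open>x\<close> for positive conductances.\<close>

definition head_resistance :: "(nat set \<Rightarrow> real) \<Rightarrow> nat \<Rightarrow> ennreal" where
  "head_resistance c x = (\<Sum>j<x. resistance c j)"

lemma head_resistance_Suc: "head_resistance c (Suc x) = head_resistance c x + resistance c x"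
  by (simp add: head_resistance_def)

lemma transition_head_resistance:
  assumes pos: "\<And>j. 0 < c {j, Suc j}"
  shows "(\<integral>\<^sup>+v. head_resistance c v * ennreal (transition_prob nat_edges c x v) \<partial>count_space UNIV)
    = head_resistance c (max 1 x)"
proof (cases x)
  case 0
  then show ?thesis
    using pos by (simp add: transition_sum_0)
next
  case (Suc y)
  have "head_resistance c (Suc x) = head_resistance c y +
      (ennreal (1 / c {Suc y, Suc (Suc y)}) + ennreal (1 / c {y, Suc y}))"
    by (simp add: Suc head_resistance_Suc resistance_def ac_simps)
  then show ?thesis
    unfolding Suc transition_sum_Suc
    \<comment> \<open>This potential grows away from 0, so the two edges at \<open>Suc y\<close>
      exchange roles compared with the tail.\<close>
    using ennreal_weighted_resistance[OF pos pos, of "head_resistance c y" "Suc y" y]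
    by (simp add: head_resistance_Suc[of c y] resistance_def add.commute)
qed

text \<open>Infinite resistance would force a return to 0 after every time, contradicting transience
  of the walk started at 0.\<close>

lemma transient_graph_finite_resistance:
  assumes "transient_graph nat_edges c" and pos: "\<And>e. e \<in> nat_edges \<Longrightarrow> 0 < c e"
  shows "tail_resistance c 0 < \<top>"
proof (rule ccontr)
  assume "\<not> tail_resistance c 0 < \<top>"
  then have tail: "tail_resistance c 0 = \<top>"
    by (metis top.not_eq_extremum)
  obtain P where P: "rwce P nat_edges (\<lambda>t \<omega>. \<omega> t) (\<lambda>t \<omega>. c)"
    and start: "AE \<omega> in P. \<omega> 0 = 0" and transient: "transient_walk P (\<lambda>t \<omega>. \<omega> t)"
    using assms(1) unfolding transient_graph_def weighted_walk_law_def by blast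
  interpret P: rwce P nat_edges "\<lambda>t \<omega>. \<omega> t" "\<lambda>t \<omega>. c"
    by (rule P)
  note P.X_measurable[measurable]
  let ?h = "head_resistance c"
  have lim: "?h \<longlonglongrightarrow> \<top>"
    using summable_LIMSEQ[of "resistance c"] tail
    by (simp add: head_resistance_def[abs_def] tail_resistance_def)
  have drift: "(\<integral>\<^sup>+v. ?h v * ennreal (transition_prob nat_edges c x v) \<partial>count_space UNIV)
      = ?h x + (if x = 0 then resistance c 0 else 0)" for x
    by (cases x) (simp_all add: transition_head_resistance pos, simp add: head_resistance_def)
  \<comment> \<open>Only visits to 0 raise the mean, each time by at most the finite
    \<open>resistance c 0\<close>. The value at time \<open>T\<close> later bounds the Fatou
    limit.\<close>
  have e_finite: "(\<integral>\<^sup>+\<omega>. ?h (\<omega> t) \<partial>P) < \<top>" for t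
  proof (induction t)
    case 0
    have "(\<integral>\<^sup>+\<omega>. ?h (\<omega> 0) \<partial>P) = (\<integral>\<^sup>+\<omega>. 0 \<partial>P)"
      by (rule nn_integral_cong_AE) (use start in eventually_elim, simp add: head_resistance_def)
    then show ?case
      by simp
  next
    case (Suc t)
    have "(\<integral>\<^sup>+\<omega>. ?h (\<omega> (Suc t)) \<partial>P)
        = (\<integral>\<^sup>+\<omega>. ?h (\<omega> t) + (if \<omega> t = 0 then resistance c 0 else 0) \<partial>P)"
      by (subst P.nn_integral_step[where \<phi> = "\<lambda>v _. ?h v"]) (simp_all add: drift)
    also have "\<dots> \<le> (\<integral>\<^sup>+\<omega>. ?h (\<omega> t) + resistance c 0 \<partial>P)"
      by (rule nn_integral_mono) simp
    also have "\<dots> = (\<integral>\<^sup>+\<omega>. ?h (\<omega> t) \<partial>P) + resistance c 0"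
      by (subst nn_integral_add) (simp_all add: P.emeasure_space_1)
    also have "\<dots> < \<top>"
      using Suc by (simp add: resistance_def)
    finally show ?case .
  qed
  have return: "AE \<omega> in P. \<exists>s\<ge>T. \<omega> s = 0" for T
  proof -
    \<comment> \<open>Avoiding 0 from \<open>T\<close> up to \<open>t\<close> is decided by the
      history at \<open>t\<close>, so its indicator can be a factor in the one-step formula.\<close>
    define B where "B t = {\<omega> \<in> space P. \<forall>s\<in>{T..t}. \<omega> s \<noteq> 0}" for t
    have B_history: "B t \<in> sets (history P nat_edges (\<lambda>t \<omega>. \<omega> t) (\<lambda>t \<omega>. c) t)" for t
    proof -
      have "{\<omega> \<in> space (history P nat_edges (\<lambda>t \<omega>. \<omega> t) (\<lambda>t \<omega>. c) t). \<forall>s\<in>{T..t}. \<omega> s \<noteq> 0}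
          \<in> sets (history P nat_edges (\<lambda>t \<omega>. \<omega> t) (\<lambda>t \<omega>. c) t)"
      proof (rule sets.sets_Collect_finite_All)
        fix s assume "s \<in> {T..t}"
        then have "(\<lambda>\<omega>. \<omega> s) \<in> measurable (history P nat_edges (\<lambda>t \<omega>. \<omega> t) (\<lambda>t \<omega>. c) t)
            (count_space UNIV)"
          using P.measurable_history_position[of s t] by simp
        from measurable_sets[OF this, of "- {0}"]
        show "{\<omega> \<in> space (history P nat_edges (\<lambda>t \<omega>. \<omega> t) (\<lambda>t \<omega>. c) t). \<omega> s \<noteq> 0}
            \<in> sets (history P nat_edges (\<lambda>t \<omega>. \<omega> t) (\<lambda>t \<omega>. c) t)"
          by (simp add: vimage_def Int_def conj_commute)
      qed simp
      then show ?thesis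
        by (simp add: B_def)
    qed
    have [measurable]: "B t \<in> sets P" for t
      using B_history P.subalgebra_history by (auto simp: subalgebra_def)
    define f where "f t \<omega> = indicator (B t) \<omega> * ?h (\<omega> t)" for t \<omega>
    have f[measurable]: "f t \<in> borel_measurable P" for t
      unfolding f_def by measurable
    have f_bound: "(\<integral>\<^sup>+\<omega>. f t \<omega> \<partial>P) \<le> (\<integral>\<^sup>+\<omega>. ?h (\<omega> T) \<partial>P)" if "T \<le> t" for t
      using that
    proof (induction t rule: dec_induct)
      case base
      show ?case
        by (rule nn_integral_mono) (simp add: f_def indicator_def)
    next
      case (step t)
      have "(\<integral>\<^sup>+\<omega>. f (Suc t) \<omega> \<partial>P) \<le> (\<integral>\<^sup>+\<omega>. indicator (B t) \<omega> * ?h (\<omega> (Suc t)) \<partial>P)"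
        by (rule nn_integral_mono) (auto simp: f_def B_def indicator_def)
      also have "\<dots> = (\<integral>\<^sup>+\<omega>. indicator (B t) \<omega> *
          (?h (\<omega> t) + (if \<omega> t = 0 then resistance c 0 else 0)) \<partial>P)"
        using B_history[of t]
        by (subst P.nn_integral_step[where \<phi> = "\<lambda>v \<omega>. indicator (B t) \<omega> * ?h v"])
          (simp_all add: mult.assoc nn_integral_cmult drift)
      also have "\<dots> = (\<integral>\<^sup>+\<omega>. f t \<omega> \<partial>P)"
        \<comment> \<open>Since \<open>T \<le> t\<close>, the time \<open>t\<close> itself is among
          those at which \<open>B t\<close> forbids 0, so the drift term vanishes.\<close>
        using step.hyps by (intro nn_integral_cong) (auto simp: f_def B_def indicator_def dest!: bspec[of _ _ t])
      finally show ?case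
        using step.IH by simp
    qed
    have "(\<integral>\<^sup>+\<omega>. liminf (\<lambda>t. f t \<omega>) \<partial>P) \<le> liminf (\<lambda>t. \<integral>\<^sup>+\<omega>. f t \<omega> \<partial>P)"
      by (rule nn_integral_liminf) measurable
    also have "\<dots> \<le> liminf (\<lambda>t. \<integral>\<^sup>+\<omega>. ?h (\<omega> T) \<partial>P)"
      by (rule Liminf_mono) (use f_bound in \<open>auto simp: eventually_sequentially\<close>)
    also have "\<dots> < \<top>"
      using e_finite by (simp add: Liminf_const)
    finally have "AE \<omega> in P. liminf (\<lambda>t. f t \<omega>) \<noteq> \<infinity>"
      by (intro nn_integral_PInf_AE) auto
    then show ?thesis
      using transient[unfolded transient_walk_def] AE_space
    proof eventually_elim
      case (elim \<omega>)
      show ?case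
      proof (rule ccontr)
        assume no: "\<not> (\<exists>s\<ge>T. \<omega> s = 0)"
        \<comment> \<open>Each level has only finitely many vertices below it, each visited finitely
          often, so the path tends to infinity.\<close>
        have "filterlim \<omega> at_top sequentially"
          unfolding filterlim_at_top
        proof
          fix z
          have "finite {t. \<omega> t < z}"
            using elim(2) by (auto intro: finite_subset[of _ "\<Union>v<z. {t. \<omega> t = v}"])
          then have "eventually (\<lambda>t. t \<notin> {t. \<omega> t < z}) sequentially"
            by (simp add: eventually_cofinite flip: cofinite_eq_sequentially)
          then show "eventually (\<lambda>t. z \<le> \<omega> t) sequentially"
            by eventually_elim auto
        qed
        then have "(\<lambda>t. ?h (\<omega> t)) \<longlonglongrightarrow> \<top>"
          by (rule filterlim_compose[OF lim])
        moreover have "f t \<omega> = ?h (\<omega> t)" for t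
          using no elim(3) by (auto simp: f_def B_def)
        ultimately have "(\<lambda>t. f t \<omega>) \<longlonglongrightarrow> \<top>"
          by simp
        from lim_imp_Liminf[OF sequentially_bot this] elim(1) show False
          by simp
      qed
    qed
  qed
  have "AE \<omega> in P. \<forall>T. \<exists>s\<ge>T. \<omega> s = 0"
    using return by (simp add: AE_all_countable)
  then have "AE \<omega> in P. False"
    using transient[unfolded transient_walk_def]
    by eventually_elim (metis (mono_tags) finite_nat_set_iff_bounded_le mem_Collect_eq not_less_eq_eq)
  then show False
    by simp
qed

section \<open>Expected numbers of visits in a bounded increasing environment\<close>

locale bounded_increasing_walk = rwce M nat_edges X C
  for M :: "'w measure" and X :: "nat \<Rightarrow> 'w \<Rightarrow> nat" and C :: "nat \<Rightarrow> 'w \<Rightarrow> nat set \<Rightarrow> real" +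
  fixes C_inf :: "nat set \<Rightarrow> real"
  assumes proper: "proper_env M nat_edges C"
    and increasing: "increasing_env M nat_edges C"
    and bounded: "bounded_above_env M nat_edges C C_inf"
begin

lemma AE_env:
  "AE \<omega> in M. \<forall>t. \<forall>e\<in>nat_edges. 0 < C t \<omega> e \<and> C t \<omega> e \<le> C (Suc t) \<omega> e \<and> C 0 \<omega> e \<le> C t \<omega> e
    \<and> C t \<omega> e \<le> C_inf e"
  using proper[unfolded proper_env_def] increasing[unfolded increasing_env_def]
    bounded[unfolded bounded_above_env_def]
proof eventually_elim
  case (elim \<omega>)
  have "C 0 \<omega> e \<le> C t \<omega> e" if "e \<in> nat_edges" for t e
    using lift_Suc_mono_le[of "\<lambda>t. C t \<omega> e" 0 t] elim(2) that by simp
  then show ?case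
    using elim by blast
qed

text \<open>\<open>C_inf\<close> is deterministic, so an almost sure inequality for it holds
  outright on a probability space.\<close>

lemma C_inf_pos:
  assumes "e \<in> nat_edges"
  shows "0 < C_inf e"
proof -
  have "AE \<omega> in M. 0 < C_inf e"
    using AE_env by eventually_elim (use assms in \<open>meson less_le_trans\<close>)
  then show ?thesis
    by simp
qed

lemma measurable_tail_resistance:
  assumes "s \<le> t"
  shows "(\<lambda>\<omega>. tail_resistance (C s \<omega>) x) \<in> borel_measurable (history M nat_edges X C t)"
proof -
  have [measurable]: "(\<lambda>\<omega>. C s \<omega> {j, Suc j}) \<in> borel_measurable (history M nat_edges X C t)" for j
    using assms by (intro measurable_history_conductance) auto
  show ?thesis
    unfolding tail_resistance_def resistance_def by measurable
qed

text \<open>The initial resistance is random and need not have finite mean. Truncating it by an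
  event known at time 0 gives a bounded start and keeps the one-step formula applicable.\<close>

definition start_event :: "nat \<Rightarrow> 'w set" where
  "start_event k = {\<omega> \<in> space M. tail_resistance (C 0 \<omega>) 0 \<le> of_nat k}"

lemma start_event_history: "start_event k \<in> sets (history M nat_edges X C t)"
proof -
  note measurable_tail_resistance[of 0 t, measurable]
  have "{\<omega> \<in> space (history M nat_edges X C t). tail_resistance (C 0 \<omega>) 0 \<le> of_nat k}
      \<in> sets (history M nat_edges X C t)"
    by measurable
  then show ?thesis
    by (simp add: start_event_def)
qed

lemma start_event_sets [measurable]: "start_event k \<in> sets M"
  using start_event_history subalgebra_history by (auto simp: subalgebra_def)

definition visit :: "nat \<Rightarrow> nat \<Rightarrow> nat \<Rightarrow> 'w \<Rightarrow> ennreal" where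
  "visit k v t \<omega> = indicator (start_event k) \<omega> * (if X t \<omega> = v then 1 else 0)"

lemma measurable_visit [measurable]: "visit k v t \<in> borel_measurable M"
proof -
  note X_measurable[measurable]
  show ?thesis
    unfolding visit_def by measurable
qed

lemma resistance_supermartingale:
  "(\<integral>\<^sup>+\<omega>. indicator (start_event k) \<omega> * tail_resistance (C (Suc t) \<omega>) (X (Suc t) \<omega>) \<partial>M)
     + resistance C_inf 0 * (\<integral>\<^sup>+\<omega>. visit k 0 t \<omega> \<partial>M)
   \<le> (\<integral>\<^sup>+\<omega>. indicator (start_event k) \<omega> * tail_resistance (C t \<omega>) (X t \<omega>) \<partial>M)"
proof -
  note X_measurable[measurable]
  let ?A = "start_event k"
  let ?R = "\<lambda>\<omega> x. indicator ?A \<omega> * tail_resistance (C t \<omega>) x"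
  have [measurable]: "(\<lambda>\<omega>. tail_resistance (C t \<omega>) v) \<in> borel_measurable M" for v
    using measurable_from_subalg[OF subalgebra_history measurable_tail_resistance] by blast
  have R[measurable]: "(\<lambda>\<omega>. ?R \<omega> (max 1 (X t \<omega>))) \<in> borel_measurable M"
    by (rule measurable_compose_countable[where f = "\<lambda>x \<omega>. ?R \<omega> (max 1 x)" and g = "X t"]) measurable
  \<comment> \<open>The environment is compared first, at the new position: \<open>C (Suc t)\<close>
    may depend on that position, whereas \<open>C t\<close> belongs to the history over which the
    step is averaged.\<close>
  have "(\<integral>\<^sup>+\<omega>. indicator ?A \<omega> * tail_resistance (C (Suc t) \<omega>) (X (Suc t) \<omega>) \<partial>M)
      \<le> (\<integral>\<^sup>+\<omega>. ?R \<omega> (X (Suc t) \<omega>) \<partial>M)"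
    by (rule nn_integral_mono_AE, use AE_env in eventually_elim)
      (intro mult_left_mono tail_resistance_mono; simp)
  also have "\<dots> = (\<integral>\<^sup>+\<omega>. indicator ?A \<omega> * (\<integral>\<^sup>+v. tail_resistance (C t \<omega>) v *
      ennreal (transition_prob nat_edges (C t \<omega>) (X t \<omega>) v) \<partial>count_space UNIV) \<partial>M)"
    using start_event_history[of k t] measurable_tail_resistance[of t t]
    by (subst nn_integral_step[where \<phi> = "\<lambda>v \<omega>. ?R \<omega> v"])
      (simp_all add: mult.assoc nn_integral_cmult)
  also have "\<dots> = (\<integral>\<^sup>+\<omega>. ?R \<omega> (max 1 (X t \<omega>)) \<partial>M)"
    by (rule nn_integral_cong_AE, use AE_env in eventually_elim)
      (simp add: transition_tail_resistance)
  finally have "(\<integral>\<^sup>+\<omega>. indicator ?A \<omega> * tail_resistance (C (Suc t) \<omega>) (X (Suc t) \<omega>) \<partial>M)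
       + resistance C_inf 0 * (\<integral>\<^sup>+\<omega>. visit k 0 t \<omega> \<partial>M)
     \<le> (\<integral>\<^sup>+\<omega>. ?R \<omega> (max 1 (X t \<omega>)) \<partial>M) + resistance C_inf 0 * (\<integral>\<^sup>+\<omega>. visit k 0 t \<omega> \<partial>M)"
    by (rule add_right_mono)
  also have "\<dots> = (\<integral>\<^sup>+\<omega>. ?R \<omega> (max 1 (X t \<omega>)) + resistance C_inf 0 * visit k 0 t \<omega> \<partial>M)"
    by (simp add: nn_integral_add nn_integral_cmult)
  also have "\<dots> \<le> (\<integral>\<^sup>+\<omega>. ?R \<omega> (X t \<omega>) \<partial>M)"
  proof (rule nn_integral_mono_AE, use AE_env in eventually_elim)
    case (elim \<omega>)
    show ?case
    proof (cases "X t \<omega> = 0")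
      case True
      \<comment> \<open>The upper bound on conductances makes the loss at each visit to 0
        deterministic and uniform in time.\<close>
      have "resistance C_inf 0 \<le> resistance (C t \<omega>) 0"
        unfolding resistance_def using elim
        by (intro ennreal_leI divide_left_mono mult_pos_pos C_inf_pos) auto
      then have "tail_resistance (C t \<omega>) 1 + resistance C_inf 0 \<le> tail_resistance (C t \<omega>) 0"
        by (simp add: tail_resistance_Suc[of _ 0] add_left_mono)
      then show ?thesis
        using True by (simp add: visit_def indicator_def)
    next
      case False
      then show ?thesis
        by (simp add: visit_def max_def)
    qed
  qed
  finally show ?thesis .
qed

lemma expected_visits_0: "(\<Sum>t. \<integral>\<^sup>+\<omega>. visit k 0 t \<omega> \<partial>M) < \<top>"
proof -
  let ?a = "\<lambda>t. \<integral>\<^sup>+\<omega>. indicator (start_event k) \<omega> * tail_resistance (C t \<omega>) (X t \<omega>) \<partial>M"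
  let ?V = "\<lambda>t. \<integral>\<^sup>+\<omega>. visit k 0 t \<omega> \<partial>M"
  have "?a 0 \<le> (\<integral>\<^sup>+\<omega>. of_nat k \<partial>M)"
  proof (rule nn_integral_mono)
    fix \<omega>
    have "tail_resistance (C 0 \<omega>) (X 0 \<omega>) \<le> tail_resistance (C 0 \<omega>) 0"
      by (rule tail_resistance_antimono) simp
    then show "indicator (start_event k) \<omega> * tail_resistance (C 0 \<omega>) (X 0 \<omega>) \<le> of_nat k"
      by (auto simp: indicator_def start_event_def)
  qed
  then have a0: "?a 0 \<le> of_nat k"
    by (simp add: emeasure_space_1)
  \<comment> \<open>The telescoped supermartingale inequality, kept additive to avoid subtraction in
    \<open>ennreal\<close>.\<close>
  have bound: "?a n + resistance C_inf 0 * (\<Sum>t<n. ?V t) \<le> of_nat k" for n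
  proof (induction n)
    case 0
    then show ?case
      using a0 by simp
  next
    case (Suc n)
    have "?a (Suc n) + resistance C_inf 0 * (\<Sum>t<Suc n. ?V t)
        = (?a (Suc n) + resistance C_inf 0 * ?V n) + resistance C_inf 0 * (\<Sum>t<n. ?V t)"
      by (simp add: distrib_left ac_simps)
    also have "\<dots> \<le> ?a n + resistance C_inf 0 * (\<Sum>t<n. ?V t)"
      by (rule add_right_mono) (rule resistance_supermartingale)
    finally show ?case
      using Suc by (rule order_trans)
  qed
  have partial: "(\<Sum>t<n. resistance C_inf 0 * ?V t) \<le> of_nat k" for n
    by (rule order_trans[OF _ bound[of n]]) (simp add: sum_distrib_left)
  have "(\<Sum>t. resistance C_inf 0 * ?V t) \<le> of_nat k"
    unfolding suminf_eq_SUP by (rule SUP_least) (rule partial)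
  then have "resistance C_inf 0 * (\<Sum>t. ?V t) \<le> of_nat k"
    by simp
  moreover have "0 < resistance C_inf 0"
    using C_inf_pos[of "{0, Suc 0}"] by (simp add: resistance_def)
  ultimately show ?thesis
    by (auto simp: ennreal_mult_less_top dest!: le_less_trans[OF _ of_nat_less_top])
qed

text \<open>From \<open>Suc v\<close> the walk steps to \<open>v\<close> with conditional
  probability at least \<open>\<epsilon>\<close> on the start event: there the edge towards
  \<open>v\<close> has conductance at least \<open>1 / real k\<close>, and \<open>C_inf\<close>
  bounds both edges from above.\<close>

lemma expected_visits_step:
  fixes k v :: nat
  assumes "0 < k"
  defines "\<epsilon> \<equiv> (1 / real k) / (C_inf {v, Suc v} + C_inf {Suc v, Suc (Suc v)})"
  shows "ennreal \<epsilon> * (\<integral>\<^sup>+\<omega>. visit k (Suc v) t \<omega> \<partial>M) \<le> (\<integral>\<^sup>+\<omega>. visit k v (Suc t) \<omega> \<partial>M)"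
proof -
  have "ennreal \<epsilon> * (\<integral>\<^sup>+\<omega>. visit k (Suc v) t \<omega> \<partial>M) = (\<integral>\<^sup>+\<omega>. ennreal \<epsilon> * visit k (Suc v) t \<omega> \<partial>M)"
    by (simp add: nn_integral_cmult)
  also have "\<dots> \<le> (\<integral>\<^sup>+\<omega>. indicator (start_event k) \<omega> * 
      ennreal (transition_prob nat_edges (C t \<omega>) (X t \<omega>) v) \<partial>M)"
  proof (rule nn_integral_mono_AE, use AE_env in eventually_elim)
    case (elim \<omega>)
    have env: "0 < C s \<omega> {j, Suc j}" "C 0 \<omega> {j, Suc j} \<le> C s \<omega> {j, Suc j}"
      "C s \<omega> {j, Suc j} \<le> C_inf {j, Suc j}" for s j
      using elim by simp_all
    have "\<epsilon> \<le> transition_prob nat_edges (C t \<omega>) (Suc v) v" if "\<omega> \<in> start_event k"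
    proof -
      \<comment> \<open>One edge of the series has at most the resistance of the whole; monotonicity
        then carries the resulting conductance bound from time 0 to time \<open>t\<close>.\<close>
      have "resistance (C 0 \<omega>) v \<le> of_nat k"
        using that resistance_le_tail[of "C 0 \<omega>" v] by (auto simp: start_event_def)
      then have "1 / C 0 \<omega> {v, Suc v} \<le> real k"
        by (simp add: resistance_def ennreal_of_nat_eq_real_of_nat)
      then have "1 / real k \<le> C 0 \<omega> {v, Suc v}"
        using assms(1) env(1)[of 0 v] by (simp add: divide_simps mult.commute)
      then have "1 / real k \<le> C t \<omega> {v, Suc v}"
        using env(2)[of v t] by simp
      then have "\<epsilon> \<le> C t \<omega> {v, Suc v} / (C t \<omega> {v, Suc v} + C t \<omega> {Suc v, Suc (Suc v)})"
        unfolding \<epsilon>_def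
        using env(1)[of t v] env(1)[of t "Suc v"] env(3)[of t v] env(3)[of t "Suc v"]
        by (intro frac_le) auto
      then show ?thesis
        by (simp add: transition_prob_def nat_edges_iff total_conductance_Suc insert_commute)
    qed
    then show ?case
      by (auto simp: visit_def indicator_def intro: ennreal_leI)
  qed
  \<comment> \<open>Writing the single probability as a sum over all targets \<open>u\<close> brings
    it into the form of the one-step formula.\<close>
  also have "\<dots> = (\<integral>\<^sup>+\<omega>. (\<integral>\<^sup>+u. indicator (start_event k) \<omega> * (if u = v then 1 else 0) *
      ennreal (transition_prob nat_edges (C t \<omega>) (X t \<omega>) u) \<partial>count_space UNIV) \<partial>M)"
    by (rule nn_integral_cong, subst nn_integral_count_space'[where A = "{v}"]) (simp_all add: indicator_def)
  also have "\<dots> = (\<integral>\<^sup>+\<omega>. visit k v (Suc t) \<omega> \<partial>M)"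
    unfolding visit_def using start_event_history[of k t]
    by (subst nn_integral_step[where
          \<phi> = "\<lambda>u \<omega>. indicator (start_event k) \<omega> * (if u = v then 1 else 0)"]) simp_all
  finally show ?thesis .
qed

lemma expected_visits:
  assumes "0 < k"
  shows "(\<Sum>t. \<integral>\<^sup>+\<omega>. visit k v t \<omega> \<partial>M) < \<top>"
proof (induction v)
  case 0
  show ?case
    by (rule expected_visits_0)
next
  case (Suc v)
  define \<epsilon> where "\<epsilon> = (1 / real k) / (C_inf {v, Suc v} + C_inf {Suc v, Suc (Suc v)})"
  have "0 < \<epsilon>"
    using assms C_inf_pos[of "{v, Suc v}"] C_inf_pos[of "{Suc v, Suc (Suc v)}"] by (simp add: \<epsilon>_def)
  have "ennreal \<epsilon> * (\<Sum>t. \<integral>\<^sup>+\<omega>. visit k (Suc v) t \<omega> \<partial>M) \<le> (\<Sum>t. \<integral>\<^sup>+\<omega>. visit k v (Suc t) \<omega> \<partial>M)"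
    unfolding ennreal_suminf_cmult[symmetric]
    by (intro suminf_le summableI) (use expected_visits_step[OF assms] in \<open>simp add: \<epsilon>_def\<close>)
  \<comment> \<open>The shifted sum omits only the possible visit at time 0.\<close>
  also have "\<dots> \<le> (\<Sum>t. \<integral>\<^sup>+\<omega>. visit k v t \<omega> \<partial>M)"
    by (subst (2) suminf_offset[where i = 1]) simp_all
  finally have "ennreal \<epsilon> * (\<Sum>t. \<integral>\<^sup>+\<omega>. visit k (Suc v) t \<omega> \<partial>M) < \<top>"
    using Suc by (rule le_less_trans)
  with \<open>0 < \<epsilon>\<close> show ?case
    by (auto simp: ennreal_mult_less_top)
qed

lemma transient_on_start_event:
  assumes "0 < k"
  shows "AE \<omega> in M. \<omega> \<in> start_event k \<longrightarrow> finite {t. X t \<omega> = v}"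
proof -
  have "(\<integral>\<^sup>+\<omega>. (\<Sum>t. visit k v t \<omega>) \<partial>M) < \<top>"
    using expected_visits[OF assms] by (simp add: nn_integral_suminf)
  then have "AE \<omega> in M. (\<Sum>t. visit k v t \<omega>) \<noteq> \<infinity>"
    by (intro nn_integral_PInf_AE) auto
  then show ?thesis
  proof eventually_elim
    case (elim \<omega>)
    show ?case
    proof
      assume "\<omega> \<in> start_event k"
      \<comment> \<open>On the start event the series is the counting measure of the visit times,
        finite exactly when their set is.\<close>
      then have "(\<Sum>t. visit k v t \<omega>) = (\<integral>\<^sup>+t. indicator {t. X t \<omega> = v} t \<partial>count_space UNIV)"
        by (subst nn_integral_count_space_nat) (auto simp: visit_def indicator_def intro!: suminf_cong)
      also have "\<dots> = emeasure (count_space UNIV) {t. X t \<omega> = v}"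
        by simp
      finally show "finite {t. X t \<omega> = v}"
        using elim by (auto simp: emeasure_count_space split: if_splits)
    qed
  qed
qed

end

theorem theorem4p2:
  fixes M :: "'w measure"
    and X :: "nat \<Rightarrow> 'w \<Rightarrow> nat"
    and C :: "nat \<Rightarrow> 'w \<Rightarrow> nat set \<Rightarrow> real"
    and C_inf :: "nat set \<Rightarrow> real"
  assumes "rwce M nat_edges X C"
    and "proper_env M nat_edges C"
    and "increasing_env M nat_edges C"
    and "AE \<omega> in M. transient_graph nat_edges (C 0 \<omega>)"
    and "transient_graph nat_edges C_inf"
    and "bounded_above_env M nat_edges C C_inf"
  shows "transient_walk M X"
proof -
  interpret bounded_increasing_walk M X C C_inf
    using assms by (simp add: bounded_increasing_walk_def bounded_increasing_walk_axioms_def)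
  have "AE \<omega> in M. \<forall>k v. 0 < k \<longrightarrow> \<omega> \<in> start_event k \<longrightarrow> finite {t. X t \<omega> = v}"
    unfolding AE_all_countable using transient_on_start_event by auto
  then show ?thesis
    unfolding transient_walk_def using assms(4) AE_env AE_space
  proof eventually_elim
    case (elim \<omega>)
    \<comment> \<open>The deterministic criterion is applied to the realized initial conductances,
      so almost every outcome lies in some start event.\<close>
    have "tail_resistance (C 0 \<omega>) 0 < \<top>"
      using elim by (intro transient_graph_finite_resistance) auto
    then obtain n where "tail_resistance (C 0 \<omega>) 0 \<le> of_nat n"
      using ennreal_Ex_less_of_nat by (meson less_imp_le)
    \<comment> \<open>Passing to \<open>Suc n\<close> makes the index positive.\<close>
    then have "\<omega> \<in> start_event (Suc n)"
      using elim(4) by (auto simp: start_event_def intro: order_trans)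
    then show ?case
      using elim(1) by blast
  qed
qed

end
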